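(* For every positive integer $n$ there exist consistent propositional formulae $R$ and $K_1,\ldots,K_m$ such that $R$ is obtainable by priority base merging from $K_1,\ldots,K_m$, but only with priority partitions having $n$ classes or more (that is, every priority ordering for which the result of merging $K_1,\ldots,K_m$ is equivalent to $R$ has at least $n$ classes).
   Context: A maxset of $K_1,\ldots,K_m$ is a maximal (under inclusion) consistent subset $M\subseteq\{K_1,\ldots,K_m\}$; in a disjunction, a maxset stands for the conjunction of its formulae. A priority ordering (priority partition) is an ordered partition $P(1),P(2),\ldots,P(k)$ of $\{K_1,\ldots,K_m\}$ into nonempty classes. For $L,N\subseteq\{K_1,\ldots,K_m\}$, $L<N$ iff there is $i$ such that $P(j)\cap L=P(j)\cap N$ for all $j<i$ and $P(i)\cap L\supsetneq P(i)\cap N$. The result of (priority base) merging with $P$ is the disjunction of all maxsets $M$ that are minimal, i.e. such that no maxset $N$ satisfies $N<M$. $R$ is obtainable from $K_1,\ldots,K_m$ if it is equivalent to the result of merging with some priority ordering. *)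

theory Defs
  imports Main "HOL-Library.Disjoint_Sets"
begin

datatype 'a formula =
    Atom 'a
  | Falsum
  | Neg "'a formula"
  | And "'a formula" "'a formula"
  | Or "'a formula" "'a formula"
  | Imp "'a formula" "'a formula"

primrec models :: "('a \<Rightarrow> bool) \<Rightarrow> 'a formula \<Rightarrow> bool" where
  "models v (Atom x) \<longleftrightarrow> v x"
| "models v Falsum \<longleftrightarrow> False"
| "models v (Neg F) \<longleftrightarrow> \<not> models v F"
| "models v (And F G) \<longleftrightarrow> models v F \<and> models v G"
| "models v (Or F G) \<longleftrightarrow> models v F \<or> models v G"
| "models v (Imp F G) \<longleftrightarrow> (models v F \<longrightarrow> models v G)"

definition consistent :: "'a formula set \<Rightarrow> bool" where
  "consistent S \<longleftrightarrow> (\<exists>v. \<forall>F\<in>S. models v F)"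

definition equivalent :: "'a formula \<Rightarrow> 'a formula \<Rightarrow> bool" where
  "equivalent F G \<longleftrightarrow> (\<forall>v. models v F \<longleftrightarrow> models v G)"

text \<open>
  Conjunction and disjunction of a finite set of formulae. The order in which the elements are
  listed is arbitrary; it affects the resulting formula only up to equivalence.
\<close>

definition enumeration :: "'a set \<Rightarrow> 'a list" where
  "enumeration S = (SOME xs. distinct xs \<and> set xs = S)"

definition Conj :: "'a formula set \<Rightarrow> 'a formula" where
  "Conj S = foldr And (enumeration S) (Neg Falsum)"

definition Disj :: "'a formula set \<Rightarrow> 'a formula" where
  "Disj S = foldr Or (enumeration S) Falsum"

lemma set_enumeration: "finite S \<Longrightarrow> set (enumeration S) = S"
  unfolding enumeration_def
  by (metis (mono_tags, lifting) finite_distinct_list someI_ex)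

lemma models_Conj: "finite S \<Longrightarrow> models v (Conj S) \<longleftrightarrow> (\<forall>F\<in>S. models v F)"
proof -
  have "models v (foldr And xs (Neg Falsum)) \<longleftrightarrow> (\<forall>F\<in>set xs. models v F)" for xs
    by (induction xs) auto
  then show "finite S \<Longrightarrow> ?thesis" by (simp add: Conj_def set_enumeration)
qed

lemma models_Disj: "finite S \<Longrightarrow> models v (Disj S) \<longleftrightarrow> (\<exists>F\<in>S. models v F)"
proof -
  have "models v (foldr Or xs Falsum) \<longleftrightarrow> (\<exists>F\<in>set xs. models v F)" for xs
    by (induction xs) auto
  then show "finite S \<Longrightarrow> ?thesis" by (simp add: Disj_def set_enumeration)
qed

definition maxset :: "'a formula set \<Rightarrow> 'a formula set \<Rightarrow> bool" where
  "maxset K M \<longleftrightarrow> M \<subseteq> K \<and> consistent M \<and>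
     (\<forall>N. N \<subseteq> K \<and> consistent N \<and> M \<subseteq> N \<longrightarrow> N = M)"

text \<open>The list index is the priority, shifted to start at \<open>0\<close>: the head is the first class.\<close>

definition priority_ordering :: "'a formula set \<Rightarrow> 'a formula set list \<Rightarrow> bool" where
  "priority_ordering K P \<longleftrightarrow> distinct P \<and> partition_on K (set P)"

definition preferred ::
    "'a formula set list \<Rightarrow> 'a formula set \<Rightarrow> 'a formula set \<Rightarrow> bool" where
  "preferred P L N \<longleftrightarrow> (\<exists>i<length P.
     (\<forall>j<i. P ! j \<inter> L = P ! j \<inter> N) \<and> P ! i \<inter> N \<subset> P ! i \<inter> L)"

definition merge :: "'a formula set \<Rightarrow> 'a formula set list \<Rightarrow> 'a formula" where
  "merge K P = Disj (Conj ` {M. maxset K M \<and> \<not> (\<exists>N. maxset K N \<and> preferred P N M)})"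

definition obtainable :: "'a formula set \<Rightarrow> 'a formula \<Rightarrow> bool" where
  "obtainable K R \<longleftrightarrow> (\<exists>P. priority_ordering K P \<and> equivalent R (merge K P))"

lemma models_merge:
  assumes "finite K"
  shows "models v (merge K P) \<longleftrightarrow>
    (\<exists>M. maxset K M \<and> \<not> (\<exists>N. maxset K N \<and> preferred P N M) \<and> (\<forall>F\<in>M. models v F))"
proof -
  let ?A = "{M. maxset K M \<and> \<not> (\<exists>N. maxset K N \<and> preferred P N M)}"
  have sub: "?A \<subseteq> Pow K" by (auto simp: maxset_def)
  then have "finite ?A" using assms by (meson finite_Pow_iff finite_subset)
  moreover have "models v (Conj M) \<longleftrightarrow> (\<forall>F\<in>M. models v F)" if "M \<in> ?A" for M
    using that sub assms by (meson PowD finite_subset models_Conj subsetD)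
  ultimately show ?thesis unfolding merge_def by (auto simp: models_Disj)
qed

end

theory Submission imports Defs begin

text \<open>
  Any finite nonempty antichain \<open>F\<close> of finite sets can be realised as the collection of all
  maxsets: let the formula of \<open>x\<close> say that the atom \<open>x\<close> is true and that the set of true atoms
  belongs to \<open>F\<close>. A result of merging then amounts to the choice of a subfamily of \<open>F\<close>, so it
  remains to find a family in which some choice forces a long chain of classes.

  Take \<open>M\<^sub>i = {t\<^sub>i, s, a\<^sub>i}\<close>, \<open>N\<^sub>i = {t\<^sub>i, s, a\<^sub>i\<^sub>+\<^sub>1}\<close> and \<open>Z\<^sub>i = {t\<^sub>i, z}\<close> for \<open>i < n\<close>. If \<open>s\<close>, \<open>z\<close> and
  all \<open>t\<^sub>i\<close> form the first class and are followed by \<open>{a\<^sub>0}, \<dots>, {a\<^sub>n}\<close>, then the minimal sets are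
  the \<open>M\<^sub>i\<close> and the \<open>Z\<^sub>i\<close>. Conversely, suppose that an ordering makes the \<open>M\<^sub>i\<close> and \<open>Z\<^sub>i\<close> minimal,
  but not \<open>N\<^sub>i\<close>, which is beaten by some \<open>X\<close>. If \<open>X\<close> does not contain \<open>a\<^sub>i\<^sub>+\<^sub>1\<close>, then, as \<open>X\<close> does not
  beat \<open>M\<^sub>i\<close>, the class of \<open>a\<^sub>i\<close> precedes that of \<open>a\<^sub>i\<^sub>+\<^sub>1\<close>. Otherwise \<open>X = M\<^sub>i\<^sub>+\<^sub>1\<close>, so the class
  of \<open>t\<^sub>i\<^sub>+\<^sub>1\<close> precedes that of \<open>t\<^sub>i\<close>, and \<open>Z\<^sub>i\<^sub>+\<^sub>1\<close> beats \<open>Z\<^sub>i\<close>, which is absurd.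
\<close>

section \<open>Priority orderings as rank functions\<close>

definition beats :: "('b \<Rightarrow> nat) \<Rightarrow> 'b set \<Rightarrow> 'b set \<Rightarrow> bool" where
  "beats r L N \<longleftrightarrow> (\<exists>x\<in>L - N. \<forall>y\<in>N - L. r x < r y)"

lemma beats_image:
  assumes "inj f"
  shows "beats r (f ` L) (f ` N) \<longleftrightarrow> beats (r \<circ> f) L N"
  by (simp add: beats_def flip: image_set_diff[OF assms])

text \<open>The deciding class is that of a rank-least element of \<open>L - N\<close>: before it
  the two sets agree, and in it \<open>N\<close> has nothing that \<open>L\<close> lacks.\<close>

lemma preferred_iff_beats:
  assumes LN: "L \<subseteq> K" "N \<subseteq> K"
    and bound: "\<And>x. x \<in> K \<Longrightarrow> r x < length P"
    and nth: "\<And>x i. x \<in> K \<Longrightarrow> i < length P \<Longrightarrow> x \<in> P ! i \<longleftrightarrow> r x = i"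
  shows "preferred P L N \<longleftrightarrow> beats r L N"
proof
  assume "preferred P L N"
  then obtain i where i: "i < length P" and eq: "\<forall>j<i. P ! j \<inter> L = P ! j \<inter> N"
    and sub: "P ! i \<inter> N \<subset> P ! i \<inter> L"
    by (auto simp: preferred_def)
  from sub obtain x where x: "x \<in> P ! i" "x \<in> L" "x \<notin> N" by blast
  have "r x < r y" if "y \<in> N - L" for y
  proof (rule ccontr)
    assume "\<not> r x < r y"
    moreover have "r x = i" using x i LN nth by blast
    ultimately have "r y < i \<or> r y = i" by linarith
    moreover have "y \<in> P ! r y" using that LN nth bound by blast
    ultimately show False using eq sub that by blast
  qed
  with x show "beats r L N" by (auto simp: beats_def)
next
  assume "beats r L N"
  then obtain x0 where "x0 \<in> L - N" "\<forall>y\<in>N - L. r x0 < r y" by (auto simp: beats_def)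
  then obtain x where x: "x \<in> L - N" and less: "\<And>y. y \<in> N - L \<Longrightarrow> r x < r y"
    and least: "\<And>y. y \<in> L - N \<Longrightarrow> r x \<le> r y"
    using ex_has_least_nat[of "\<lambda>x. x \<in> L - N" x0 r] by (meson order.strict_trans1)
  have rx: "r x < length P" using x LN bound by blast
  have "P ! j \<inter> L = P ! j \<inter> N" if "j < r x" for j
  proof -
    have "y \<in> L \<longleftrightarrow> y \<in> N" if "y \<in> P ! j" "y \<in> K" for y
      using that \<open>j < r x\<close> rx nth[of y j] less[of y] least[of y] by fastforce
    with LN show ?thesis by blast
  qed
  moreover have "P ! r x \<inter> N \<subset> P ! r x \<inter> L"
  proof -
    have "y \<in> L" if "y \<in> P ! r x" "y \<in> N" for y
      using that rx nth[of y "r x"] less[of y] LN by fastforce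
    moreover have "x \<in> P ! r x" using x LN rx nth by blast
    ultimately show ?thesis using x by blast
  qed
  ultimately show "preferred P L N" using rx by (auto simp: preferred_def)
qed

lemma priority_ordering_rank:
  assumes "priority_ordering K P"
  obtains r where "\<And>x. x \<in> K \<Longrightarrow> r x < length P"
    and "\<And>x i. x \<in> K \<Longrightarrow> i < length P \<Longrightarrow> x \<in> P ! i \<longleftrightarrow> r x = i"
proof -
  have P: "distinct P" "\<Union>(set P) = K" "disjoint (set P)"
    using assms by (auto simp: priority_ordering_def partition_on_def)
  have "\<exists>i. i < length P \<and> x \<in> P ! i" if "x \<in> K" for x
    using that P(2) by (metis UnionE in_set_conv_nth)
  then obtain r where r: "\<And>x. x \<in> K \<Longrightarrow> r x < length P \<and> x \<in> P ! r x" by metis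
  have "r x = i" if "x \<in> K" "i < length P" "x \<in> P ! i" for x i
  proof -
    have "P ! r x = P ! i"
      using that r[of x] disjointD[OF P(3), of "P ! r x" "P ! i"] by auto
    then show ?thesis using that r P(1) by (simp add: nth_eq_iff_index_eq)
  qed
  with r show ?thesis by (intro that[of r]) auto
qed

text \<open>Surjectivity onto \<open>{..<m}\<close> makes every class nonempty and hence the listed
  classes distinct.\<close>

lemma priority_ordering_of_rank:
  assumes "r ` K = {..<m}"
  shows "priority_ordering K (map (\<lambda>i. {x \<in> K. r x = i}) [0..<m])"
proof -
  have *: "\<exists>x\<in>K. r x = i" if "i < m" for i
    using assms that by (metis imageE lessThan_iff)
  have "inj_on (\<lambda>i. {x \<in> K. r x = i}) {0..<m}"
    using * by (fastforce simp: inj_on_def)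
  moreover have "\<Union>((\<lambda>i. {x \<in> K. r x = i}) ` {0..<m}) = K"
    using assms by auto
  moreover have "disjoint ((\<lambda>i. {x \<in> K. r x = i}) ` {0..<m})"
    by (auto simp: disjoint_def)
  moreover have "{} \<notin> (\<lambda>i. {x \<in> K. r x = i}) ` {0..<m}"
    using * by fastforce
  ultimately show ?thesis
    by (simp add: priority_ordering_def partition_on_def distinct_map)
qed

section \<open>Realising an antichain as the family of maxsets\<close>

definition truth_set_in :: "'a set set \<Rightarrow> 'a formula" where
  "truth_set_in F =
    Disj ((\<lambda>E. Conj ((\<lambda>x. if x \<in> E then Atom x else Neg (Atom x)) ` \<Union>F)) ` F)"

definition encode :: "'a set set \<Rightarrow> 'a \<Rightarrow> 'a formula" where
  "encode F x = And (Atom x) (truth_set_in F)"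

lemma inj_encode: "inj (encode F)"
  by (auto simp: inj_def encode_def)

locale antichain =
  fixes F :: "'a set set"
  assumes finite: "finite F" "finite (\<Union>F)"
    and nonempty: "F \<noteq> {}"
    and incomparable: "\<And>A B. A \<in> F \<Longrightarrow> B \<in> F \<Longrightarrow> A \<subseteq> B \<Longrightarrow> A = B"
begin

lemma models_truth_set_in: "models v (truth_set_in F) \<longleftrightarrow> {x \<in> \<Union>F. v x} \<in> F"
proof -
  have lit: "models v (if x \<in> E then Atom x else Neg (Atom x)) \<longleftrightarrow> (v x \<longleftrightarrow> x \<in> E)" for x E
    by simp
  have "models v (truth_set_in F) \<longleftrightarrow> (\<exists>E\<in>F. \<forall>x\<in>\<Union>F. v x \<longleftrightarrow> x \<in> E)"
    using finite by (simp only: truth_set_in_def models_Disj models_Conj finite_imageI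
        ball_simps bex_simps lit)
  also have "\<dots> \<longleftrightarrow> (\<exists>E\<in>F. {x \<in> \<Union>F. v x} = E)"
    by (intro bex_cong) auto
  finally show ?thesis by simp
qed

lemma models_encode: "models v (encode F x) \<longleftrightarrow> v x \<and> {x \<in> \<Union>F. v x} \<in> F"
  by (simp add: encode_def models_truth_set_in)

lemma models_encode_mem:
  assumes "E \<in> F"
  shows "models (\<lambda>x. x \<in> E) (encode F x) \<longleftrightarrow> x \<in> E"
proof -
  have "{x \<in> \<Union>F. x \<in> E} = E" using assms by auto
  then show ?thesis using assms by (simp add: models_encode)
qed

lemma consistent_encode:
  assumes "A \<subseteq> \<Union>F"
  shows "consistent (encode F ` A) \<longleftrightarrow> (\<exists>E\<in>F. A \<subseteq> E)"
proof
  assume "consistent (encode F ` A)"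
  then obtain v where v: "\<forall>x\<in>A. v x \<and> {x \<in> \<Union>F. v x} \<in> F"
    by (auto simp: consistent_def models_encode)
  show "\<exists>E\<in>F. A \<subseteq> E"
  \<comment> \<open>The model \<open>v\<close> of an empty set may have a truth set outside
    \<open>F\<close>, so \<open>E\<close> comes from \<open>nonempty\<close> instead.\<close>
  proof (cases "A = {}")
    case True
    then show ?thesis using nonempty by auto
  next
    case False
    then have "{x \<in> \<Union>F. v x} \<in> F" using v by blast
    moreover have "A \<subseteq> {x \<in> \<Union>F. v x}" using v assms by blast
    ultimately show ?thesis by blast
  qed
next
  assume "\<exists>E\<in>F. A \<subseteq> E"
  then show "consistent (encode F ` A)"
    unfolding consistent_def using models_encode_mem by blast
qed

text \<open>The consistent sets are the images of subsets of members of \<open>F\<close>; no member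
  lies inside another, so the images of members are exactly the maximal ones.\<close>

lemma maxset_encode: "maxset (encode F ` \<Union>F) M \<longleftrightarrow> (\<exists>E\<in>F. M = encode F ` E)"
proof
  assume M: "maxset (encode F ` \<Union>F) M"
  then obtain A where A: "A \<subseteq> \<Union>F" "M = encode F ` A"
    by (auto simp: maxset_def subset_image_iff)
  with M obtain E where E: "E \<in> F" "A \<subseteq> E"
    by (auto simp: maxset_def consistent_encode)
  moreover have "consistent (encode F ` E)" "encode F ` E \<subseteq> encode F ` \<Union>F"
    using E(1) consistent_encode[of E] by blast+
  ultimately have "encode F ` E = M"
    using M A unfolding maxset_def by blast
  with E(1) show "\<exists>E\<in>F. M = encode F ` E" by blast
next
  assume "\<exists>E\<in>F. M = encode F ` E"
  then obtain E where E: "E \<in> F" "M = encode F ` E" by blast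
  have "N = M" if N: "N \<subseteq> encode F ` \<Union>F" "consistent N" "M \<subseteq> N" for N
  proof -
    obtain B where B: "B \<subseteq> \<Union>F" "N = encode F ` B"
      using N(1) by (auto simp: subset_image_iff)
    with N(2) obtain E' where E': "E' \<in> F" "B \<subseteq> E'" by (auto simp: consistent_encode)
    have "E \<subseteq> B" using N(3) E B by (simp add: inj_image_subset_iff[OF inj_encode])
    then have "B = E" using E' E(1) incomparable by blast
    with E B show ?thesis by simp
  qed
  moreover have "consistent M" "M \<subseteq> encode F ` \<Union>F"
    using E consistent_encode[of E] by blast+
  ultimately show "maxset (encode F ` \<Union>F) M" by (auto simp: maxset_def)
qed

text \<open>By incomparability, the valuation with truth set \<open>E\<close> satisfies no maxset
  but the image of \<open>E\<close>. It thus tests whether \<open>E\<close> survives the merging,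
  and equivalent results have the same survivors.\<close>

lemma models_merge_encode:
  assumes E: "E \<in> F"
    and bound: "\<And>x. x \<in> encode F ` \<Union>F \<Longrightarrow> r x < length P"
    and nth: "\<And>x i. x \<in> encode F ` \<Union>F \<Longrightarrow> i < length P \<Longrightarrow> x \<in> P ! i \<longleftrightarrow> r x = i"
  shows "models (\<lambda>x. x \<in> E) (merge (encode F ` \<Union>F) P) \<longleftrightarrow>
    \<not> (\<exists>X\<in>F. beats (r \<circ> encode F) X E)"
proof -
  have pref: "preferred P (encode F ` A) (encode F ` B) \<longleftrightarrow> beats (r \<circ> encode F) A B"
    if "A \<in> F" "B \<in> F" for A B
    using that preferred_iff_beats[of "encode F ` A" _ "encode F ` B", 
        OF _ _ bound nth]
    by (metis Union_upper image_mono beats_image[OF inj_encode])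
  have sub: "(\<forall>x\<in>A. x \<in> E) \<longleftrightarrow> A = E" if "A \<in> F" for A
    using that incomparable E by blast
  have "models (\<lambda>x. x \<in> E) (merge (encode F ` \<Union>F) P) \<longleftrightarrow>
      (\<exists>A\<in>F. \<not> (\<exists>X\<in>F. beats (r \<circ> encode F) X A) \<and> (\<forall>x\<in>A. x \<in> E))"
    using finite
    by (subst models_merge)
      (auto simp: maxset_encode pref models_encode_mem[OF E] Bex_def, metis pref)
  also have "\<dots> \<longleftrightarrow> \<not> (\<exists>X\<in>F. beats (r \<circ> encode F) X E)"
    using sub E by blast
  finally show ?thesis .
qed

end

section \<open>The ladder family\<close>

text \<open>
  In the notation of the introduction, \<open>s = 0\<close>, \<open>z = 1\<close>, \<open>t\<^sub>i = tag i\<close> and \<open>a\<^sub>i = rung i\<close>, and the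
  sets \<open>M\<^sub>i\<close>, \<open>N\<^sub>i\<close>, \<open>Z\<^sub>i\<close> are \<open>lower i\<close>, \<open>upper i\<close>, \<open>side i\<close>.
\<close>

definition tag :: "nat \<Rightarrow> nat" where "tag i = 2 * i + 2"

definition rung :: "nat \<Rightarrow> nat" where "rung i = 2 * i + 3"

lemma tag_rung_simps [simp]:
  "tag i = tag j \<longleftrightarrow> i = j" "rung i = rung j \<longleftrightarrow> i = j"
  "tag i \<noteq> rung j" "rung i \<noteq> tag j"
  "tag i \<noteq> 0" "tag i \<noteq> Suc 0" "rung i \<noteq> 0" "rung i \<noteq> Suc 0"
  "0 \<noteq> tag i" "Suc 0 \<noteq> tag i" "0 \<noteq> rung i" "Suc 0 \<noteq> rung i"
  unfolding tag_def rung_def by presburger+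

definition lower :: "nat \<Rightarrow> nat set" where "lower i = {0, tag i, rung i}"

definition upper :: "nat \<Rightarrow> nat set" where "upper i = {0, tag i, rung (Suc i)}"

definition side :: "nat \<Rightarrow> nat set" where "side i = {1, tag i}"

definition ladder :: "nat \<Rightarrow> nat set set" where
  "ladder n = lower ` {..<n} \<union> upper ` {..<n} \<union> side ` {..<n}"

lemmas ladder_defs = lower_def upper_def side_def ladder_def

lemma antichain_ladder:
  assumes "n \<ge> 1"
  shows "antichain (ladder n)"
proof
  show "finite (ladder n)" "finite (\<Union>(ladder n))"
    by (auto simp: ladder_defs)
  show "ladder n \<noteq> {}"
    using assms by (auto simp: ladder_def lessThan_empty_iff)
  fix A B assume "A \<in> ladder n" "B \<in> ladder n" and sub: "A \<subseteq> B"
  then obtain i j where "A = lower i \<or> A = upper i \<or> A = side i"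
    "B = lower j \<or> B = upper j \<or> B = side j"
    by (auto simp: ladder_def)
  with sub show "A = B"
    by (elim disjE; simp add: lower_def upper_def side_def; linarith)
qed

lemma rank_rung_less:
  assumes "i < n"
    and lower: "\<And>X. X \<in> ladder n \<Longrightarrow> \<not> beats r X (lower i)"
    and side: "\<And>X. X \<in> ladder n \<Longrightarrow> \<not> beats r X (side i)"
    and upper: "\<exists>X\<in>ladder n. beats r X (upper i)"
  shows "r (rung i) < r (rung (Suc i))"
proof -
  from upper obtain X x where X: "X \<in> ladder n" and x: "x \<in> X - upper i"
    and less: "\<And>y. y \<in> upper i - X \<Longrightarrow> r x < r y"
    by (auto simp: beats_def)
  show ?thesis
  proof (cases "rung (Suc i) \<in> X")
    case True
    then have "X = upper i \<or> X = lower (Suc i) \<and> Suc i < n"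
      using X by (auto simp: ladder_defs)
    with x have XS: "X = lower (Suc i)" "Suc i < n" by auto
    \<comment> \<open>The other two elements of \<open>X\<close>, \<open>0\<close> and
      \<open>rung (Suc i)\<close>, lie in \<open>upper i\<close>.\<close>
    with x have "x = tag (Suc i)" by (auto simp: lower_def upper_def)
    with less[of "tag i"] XS have "r (tag (Suc i)) < r (tag i)"
      by (auto simp: lower_def upper_def)
    then have "beats r (side (Suc i)) (side i)"
      by (auto simp: beats_def side_def)
    moreover have "side (Suc i) \<in> ladder n" using XS by (auto simp: ladder_def)
    ultimately show ?thesis using side by blast
  next
    case False
    then have rx: "r x < r (rung (Suc i))" using less by (auto simp: upper_def)
    \<comment> \<open>Only \<open>rung i\<close> is in \<open>lower i\<close> but not in
      \<open>upper i\<close>. Either \<open>x\<close> is this element, or some \<open>y\<close> in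
      \<open>lower i - X\<close> has rank at most \<open>r x\<close>; by \<open>less\<close> it is
      outside \<open>upper i\<close>, so it is \<open>rung i\<close>.\<close>
    have "r (rung i) \<le> r x"
    proof (cases "x \<in> lower i")
      case True
      then have "x = rung i" using x by (auto simp: lower_def upper_def)
      then show ?thesis by simp
    next
      case False
      with lower[OF X] x obtain y where "y \<in> lower i - X" "r y \<le> r x"
        by (auto simp: beats_def not_less)
      moreover from this less have "y \<notin> upper i" by (metis Diff_iff leD)
      ultimately show ?thesis by (auto simp: lower_def upper_def)
    qed
    with rx show ?thesis by linarith
  qed
qed

definition ladder_rank :: "nat \<Rightarrow> nat" where
  "ladder_rank x = (if \<exists>i. x = rung i then x div 2 else 0)"

lemma ladder_rank_simps [simp]:
  "ladder_rank (rung i) = Suc i" "ladder_rank (tag i) = 0"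
  "ladder_rank 0 = 0" "ladder_rank (Suc 0) = 0"
  by (auto simp: ladder_rank_def) (simp add: rung_def)

lemma ladder_rank_image:
  assumes "n \<ge> 1"
  shows "ladder_rank ` \<Union>(ladder n) = {..<n + 2}"
proof
  show "ladder_rank ` \<Union>(ladder n) \<subseteq> {..<n + 2}"
    by (auto simp: ladder_defs)
  show "{..<n + 2} \<subseteq> ladder_rank ` \<Union>(ladder n)"
  proof
    fix k assume k: "k \<in> {..<n + 2}"
    \<comment> \<open>Rank 1 is separate because \<open>rung 0\<close> lies in no
      \<open>upper j\<close>, whereas \<open>rung (Suc j)\<close> is found in
      \<open>upper j\<close>.\<close>
    consider "k = 0" | "k = 1" | j where "k = Suc (Suc j)" "j < n"
      using k by (metis One_nat_def add_2_eq_Suc' lessThan_iff not0_implies_Suc not_less_eq)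
    then have "\<exists>x\<in>\<Union>(ladder n). ladder_rank x = k"
    proof cases
      case 1
      then show ?thesis using assms by (intro bexI[of _ 0]) (auto simp: ladder_defs lessThan_empty_iff)
    next
      case 2
      then show ?thesis
        using assms by (intro bexI[of _ "rung 0"]) (auto simp: ladder_defs lessThan_empty_iff)
    next
      case 3
      then show ?thesis
        by (intro bexI[of _ "rung (Suc j)"]) (auto simp: ladder_defs)
    qed
    then show "k \<in> ladder_rank ` \<Union>(ladder n)" by auto
  qed
qed

lemma ladder_minimal:
  assumes "X \<in> ladder n"
  shows "\<not> beats ladder_rank X (lower i)" "\<not> beats ladder_rank X (side i)"
proof -
  obtain j where X: "X = lower j \<or> X = upper j \<or> X = side j"
    using assms by (auto simp: ladder_def)
  \<comment> \<open>No rank is below 0, so a set beating \<open>E\<close> contains every element of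
    \<open>E\<close> of rank 0.\<close>
  have rank_0: "y \<in> X" if "\<forall>y\<in>E - X. ladder_rank x < ladder_rank y" "y \<in> E" "ladder_rank y = 0"
    for x y E
    using that by (metis DiffI not_less0)
  show "\<not> beats ladder_rank X (lower i)"
  proof
    assume "beats ladder_rank X (lower i)"
    then obtain x where x: "x \<in> X - lower i"
      and less: "\<forall>y\<in>lower i - X. ladder_rank x < ladder_rank y"
      by (auto simp: beats_def)
    have "tag i \<in> X" "0 \<in> X"
      by (rule rank_0[OF less]; simp add: lower_def)+
    \<comment> \<open>Only \<open>lower i\<close> and \<open>upper i\<close> contain both
      \<open>0\<close> and \<open>tag i\<close>, and \<open>lower i\<close> does not contain
      \<open>x\<close>.\<close>
    with X x have "X = upper i" "x = rung (Suc i)"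
      by (auto simp: lower_def upper_def side_def)
    with less show False by (auto simp: lower_def upper_def)
  qed
  show "\<not> beats ladder_rank X (side i)"
  proof
    assume "beats ladder_rank X (side i)"
    then obtain x where x: "x \<in> X - side i"
      and less: "\<forall>y\<in>side i - X. ladder_rank x < ladder_rank y"
      by (auto simp: beats_def)
    have "tag i \<in> X" "1 \<in> X"
      by (rule rank_0[OF less]; simp add: side_def)+
    with X x show False by (auto simp: lower_def upper_def side_def)
  qed
qed

lemma ladder_not_minimal: "beats ladder_rank (lower i) (upper i)"
  by (auto simp: ladder_defs beats_def)

theorem corollary2:
  fixes n :: nat
  assumes "n \<ge> 1"
  shows "\<exists>(R :: nat formula) (K :: nat formula set).
    finite K \<and> consistent {R} \<and> (\<forall>F\<in>K. consistent {F}) \<and>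
    obtainable K R \<and>
    (\<forall>P. priority_ordering K P \<and> equivalent R (merge K P) \<longrightarrow> length P \<ge> n)"
proof -
  define F where "F = ladder n"
  interpret antichain F unfolding F_def using assms by (rule antichain_ladder)
  define K where "K = encode F ` \<Union>F"
  define r where "r = ladder_rank \<circ> inv (encode F)"
  define P where "P = map (\<lambda>i. {x \<in> K. r x = i}) [0..<n + 2]"
  have r_encode: "r \<circ> encode F = ladder_rank"
    by (simp add: r_def fun_eq_iff inv_f_f[OF inj_encode])
  have r_image: "r ` K = {..<n + 2}"
    using ladder_rank_image[OF assms] by (simp only: K_def image_comp r_encode flip: F_def)
  then have ord: "priority_ordering K P"
    unfolding P_def by (rule priority_ordering_of_rank)
  have "r x < length P" if "x \<in> K" for x
    using r_image that by (auto simp: P_def)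
  moreover have "x \<in> P ! i \<longleftrightarrow> r x = i" if "x \<in> K" "i < length P" for x i
    using that by (simp add: P_def del: upt_Suc)
  ultimately have result: "models (\<lambda>x. x \<in> E) (merge K P) \<longleftrightarrow> \<not> (\<exists>X\<in>F. beats ladder_rank X E)"
    if "E \<in> F" for E
    using models_merge_encode[OF that, of r P] by (simp add: K_def r_encode)
  have mem: "lower i \<in> F" "upper i \<in> F" "side i \<in> F" if "i < n" for i
    using that by (auto simp: F_def ladder_def)
  have result_lower: "models (\<lambda>x. x \<in> lower i) (merge K P)"
    and result_side: "models (\<lambda>x. x \<in> side i) (merge K P)"
    and result_upper: "\<not> models (\<lambda>x. x \<in> upper i) (merge K P)" if "i < n" for i
    using that mem result ladder_minimal[of _ n i] ladder_not_minimal[of i] by (auto simp: F_def)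

  have "n \<le> length Q" if Q: "priority_ordering K Q" "equivalent (merge K P) (merge K Q)" for Q
  proof -
    obtain q where q: "\<And>x. x \<in> K \<Longrightarrow> q x < length Q"
      "\<And>x i. x \<in> K \<Longrightarrow> i < length Q \<Longrightarrow> x \<in> Q ! i \<longleftrightarrow> q x = i"
      using priority_ordering_rank[OF Q(1)] by blast
    let ?q = "q \<circ> encode F"
    \<comment> \<open>The test valuations carry the minimal members of \<open>F\<close> over from
      \<open>P\<close> to the arbitrary ordering \<open>Q\<close>.\<close>
    have minimal_iff: "models (\<lambda>x. x \<in> E) (merge K P) \<longleftrightarrow> \<not> (\<exists>X\<in>F. beats ?q X E)"
      if "E \<in> F" for E
      using models_merge_encode[OF that, of q Q] q Q(2) by (simp add: K_def equivalent_def)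
    have step: "?q (rung i) < ?q (rung (Suc i))" if "i < n" for i
    proof (rule rank_rung_less[OF that])
      show "\<not> beats ?q X (lower i)" if "X \<in> ladder n" for X
        using that minimal_iff[OF mem(1)] result_lower \<open>i < n\<close> by (auto simp only: F_def)
      show "\<not> beats ?q X (side i)" if "X \<in> ladder n" for X
        using that minimal_iff[OF mem(3)] result_side \<open>i < n\<close> by (auto simp only: F_def)
      show "\<exists>X\<in>ladder n. beats ?q X (upper i)"
        using minimal_iff[OF mem(2)] result_upper \<open>i < n\<close> by (auto simp only: F_def)
    qed
    \<comment> \<open>Each of the \<open>n\<close> strict steps raises the rank by at least 1; as
      ranks start at 0, \<open>Q\<close> even has at least \<open>n + 1\<close> classes.\<close>
    have "i \<le> n \<Longrightarrow> i \<le> ?q (rung i)" for i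
    proof (induction i)
      case (Suc i)
      then show ?case using step[of i] by simp
    qed simp
    then have "n \<le> ?q (rung n)" by simp
    also have "encode F (rung n) \<in> K"
      using mem(2)[of "n - 1"] assms by (force simp: K_def upper_def)
    then have "?q (rung n) < length Q" using q(1) by simp
    finally show ?thesis by simp
  qed
  moreover have "finite K" using finite by (simp add: K_def)
  moreover have "consistent {merge K P}"
    using result_lower[of 0] assms by (auto simp: consistent_def)
  moreover have "\<forall>G\<in>K. consistent {G}"
    using models_encode_mem by (fastforce simp: K_def consistent_def)
  moreover have "obtainable K (merge K P)"
    using ord by (auto simp: obtainable_def equivalent_def)
  ultimately show ?thesis by blast
qed

end
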